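(* Let $G=(V,E)$ be a cograph with $V=\{1,\dots,n\}$, with associated cotree $\mathcal T=(V^{\mathcal T},E^{\mathcal T})$ and root $r$. Let $h=|V^{\mathcal T}|-|V|$ be the number of internal nodes of $\mathcal T$, and let $v^1,\dots,v^h$ be its internal nodes. For $1\le i\le h$ let $\lambda_i=\lambda^r_{\mathrm{upd}}(v^i)$ be the updated eigenvalue of $v^i$ at $r$ and $\mathcal V^{(i)}=\mathcal V^r_{\mathrm{upd}}(v^i)$ the updated modal matrix of $v^i$ at $r$. Then the nontrivial spectrum of $G$ is $$\Lambda(G)=\left(\lambda_1^{(c(v^1)-1)},\dots,\lambda_h^{(c(v^h)-1)}\right),$$ and $$\mathcal V(G)=\left[\mathcal V^{(1)},\dots,\mathcal V^{(h)}\right]$$ is a nontrivial modal matrix of $G$ associated with $\Lambda(G)$.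
   Context: Graphs are finite, simple, unweighted, undirected. $L(G)=\Delta(G)-A(G)$ is the Laplacian (degree matrix minus adjacency matrix). For a graph on $n$ nodes, $(0,\mathbf 1_n)$ is the trivial eigenpair of $L(G)$; the nontrivial spectrum $\Lambda(G)$ is the list of the remaining $n-1$ eigenvalues of $L(G)$ with multiplicity (order immaterial), and a nontrivial modal matrix associated with $\Lambda(G)=(\mu_2,\dots,\mu_n)$ is an $n\times(n-1)$ matrix $[\nu_2,\dots,\nu_n]$ of full column rank with $L(G)\nu_i=\mu_i\nu_i$. The notation $\lambda^{(q)}$ means $\lambda$ repeated $q$ times. Cographs: the union of disjoint graphs $G_1=(V_1,E_1)$, $G_2=(V_2,E_2)$ is $G_1+G_2=(V_1\cup V_2,E_1\cup E_2)$, and the join $G_1*G_2$ is obtained from $G_1+G_2$ by adding all edges $\{i,j\}$ with $i\in V_1,j\in V_2$. Cographs are the graphs obtained recursively: the single-node graph $K_1$ is a cograph, and if $G_1,\dots,G_k$ ($k>1$) are cographs then so are $G_1+\cdots+G_k$ and $G_1*\cdots*G_k$. Cotree: the cotree of a cograph $G=(V,E)$ is the (unique) rooted tree $\mathcal T$, with edges directed away from the root $r$, whose leaves are the nodes of $G$, in which every internal (non-leaf) node $v$ has at least two children and a label $\mathrm{lab}(v)\in\{0,1\}$, labels alternate between $0$ and $1$ along every path of internal nodes from the root, and such that the following holds. For a node $z$ of $\mathcal T$ let $G_{(z)}$ be the subgraph of $G$ induced on the leaves descending from $z$ ($G_{(z)}$ is the single node $z$ if $z$ is a leaf); then for internal $z$,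 $G_{(z)}$ is the union (if $\mathrm{lab}(z)=0$) or the join (if $\mathrm{lab}(z)=1$) of the graphs $G_{(u)}$ over the children $u$ of $z$, and $G_{(r)}=G$. Notation on $\mathcal T$: $\mathcal C(v)$ is the set of children of $v$ and $c(v)=|\mathcal C(v)|$; $\mathcal L(v)$ is the set of leaves descending from $v$ (with $\mathcal L(v)=\{v\}$ if $v$ is a leaf) and $l(v)=|\mathcal L(v)|$. New eigenvalue and new modal matrix: for an internal node $v$, $\lambda_{\mathrm{new}}(v)=\mathrm{lab}(v)\,l(v)$. Fix an ordering $v_1,\dots,v_k$ of the children of $v$ ($k=c(v)$) and put $n_i=l(v_i)$. $\mathcal V_{\mathrm{new}}(v)$ is the $l(v)\times(k-1)$ matrix with rows indexed by $\mathcal L(v)$ whose entry in the row of a leaf $x\in\mathcal L(v_i)$ and column $j$ ($1\le j\le k-1$) is $n_{j+1}$ if $i\le j$, $-(n_1+\cdots+n_j)$ if $i=j+1$, and $0$ if $i>j+1$. Updated eigenvalue and updated modal matrix: let $w$ be equal to $v$ or an ancestor of $v$, and let $(u_0,u_1,\dots,u_p)$ be the path from $w=u_0$ to $v=u_p$. Then $$\lambda^w_{\mathrm{upd}}(v)=\lambda_{\mathrm{new}}(v)+\sum_{i=0}^{p-1}\mathrm{lab}(u_i)\,\bigl(l(u_i)-l(u_{i+1})\bigr)$$ (so $\lambda^v_{\mathrm{upd}}(v)=\lambda_{\mathrm{new}}(v)$). $\mathcal V^w_{\mathrm{upd}}(v)$ is the $l(w)\times(c(v)-1)$ matrix with rows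 indexed by $\mathcal L(w)$ whose rows indexed by $\mathcal L(v)$ form $\mathcal V_{\mathrm{new}}(v)$ and whose other rows are zero. *)

theory Defs
  imports
    "HOL-Library.Disjoint_Sets"
    "Jordan_Normal_Form.Char_Poly"
    "Jordan_Normal_Form.DL_Rank"
begin

type_synonym 'a graph = "'a set \<times> 'a set set"

abbreviation verts :: "'a graph \<Rightarrow> 'a set" where "verts \<equiv> fst"
abbreviation edges :: "'a graph \<Rightarrow> 'a set set" where "edges \<equiv> snd"

definition simple_graph :: "'a graph \<Rightarrow> bool" where
  "simple_graph G \<longleftrightarrow> finite (verts G) \<and> (\<forall>e\<in>edges G. e \<subseteq> verts G \<and> card e = 2)"

definition induced :: "'a graph \<Rightarrow> 'a set \<Rightarrow> 'a graph" where
  "induced G S = (verts G \<inter> S, {e \<in> edges G. e \<subseteq> S})"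

definition graph_union :: "'a graph \<Rightarrow> 'a graph \<Rightarrow> 'a graph" where
  "graph_union G H = (verts G \<union> verts H, edges G \<union> edges H)"

definition cross_edges :: "'a set \<Rightarrow> 'a set \<Rightarrow> 'a set set" where
  "cross_edges A B = {{x, y} |x y. x \<in> A \<and> y \<in> B}"

definition graph_join :: "'a graph \<Rightarrow> 'a graph \<Rightarrow> 'a graph" where
  "graph_join G H =
     (verts G \<union> verts H, edges G \<union> edges H \<union> cross_edges (verts G) (verts H))"

text \<open>Unions and joins of families. The insertion lemmas below show that these are the iterated
  binary operations; in particular the order of the operands does not matter.\<close>

definition graph_Union :: "'i set \<Rightarrow> ('i \<Rightarrow> 'a graph) \<Rightarrow> 'a graph" where
  "graph_Union I Gs = (\<Union>i\<in>I. verts (Gs i), \<Union>i\<in>I. edges (Gs i))"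

definition graph_Join :: "'i set \<Rightarrow> ('i \<Rightarrow> 'a graph) \<Rightarrow> 'a graph" where
  "graph_Join I Gs =
     (\<Union>i\<in>I. verts (Gs i),
      (\<Union>i\<in>I. edges (Gs i)) \<union>
        (\<Union>i\<in>I. \<Union>j\<in>I - {i}. cross_edges (verts (Gs i)) (verts (Gs j))))"

lemma graph_Union_singleton: "graph_Union {i} Gs = Gs i"
  by (simp add: graph_Union_def)

lemma graph_Join_singleton: "graph_Join {i} Gs = Gs i"
  by (simp add: graph_Join_def)

lemma graph_Union_insert:
  "graph_Union (insert i I) Gs = graph_union (Gs i) (graph_Union I Gs)"
  by (simp add: graph_Union_def graph_union_def)

lemma cross_edges_commute: "cross_edges A B = cross_edges B A"
  unfolding cross_edges_def by (metis (no_types, opaque_lifting) insert_commute)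

lemma cross_edges_UN: "cross_edges A (\<Union>j\<in>I. B j) = (\<Union>j\<in>I. cross_edges A (B j))"
  unfolding cross_edges_def by fast

lemma graph_Join_insert:
  assumes "i \<notin> I"
  shows "graph_Join (insert i I) Gs = graph_join (Gs i) (graph_Join I Gs)"
proof -
  define C where "C k j = cross_edges (verts (Gs k)) (verts (Gs j))" for k j
  have "C k i = C i k" for k
    unfolding C_def by (rule cross_edges_commute)
  moreover have "insert i I - {k} = insert i (I - {k})" if "k \<in> I" for k
    using that assms by auto
  moreover have "insert i I - {i} = I"
    using assms by auto
  ultimately have "(\<Union>k\<in>insert i I. \<Union>j\<in>insert i I - {k}. C k j) =
      (\<Union>j\<in>I. C i j) \<union> (\<Union>k\<in>I. \<Union>j\<in>I - {k}. C k j)"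
    by auto
  moreover have "(\<Union>j\<in>I. C i j) = cross_edges (verts (Gs i)) (\<Union>j\<in>I. verts (Gs j))"
    unfolding C_def by (rule cross_edges_UN[symmetric])
  ultimately show ?thesis
    unfolding graph_Join_def graph_join_def C_def by (simp add: Un_ac)
qed

inductive cograph :: "'a graph \<Rightarrow> bool" where
  single: "cograph ({x}, {})"
| union: "\<lbrakk>(k::nat) > 1; \<And>i. i < k \<Longrightarrow> cograph (Gs i);
    disjoint_family_on (\<lambda>i. verts (Gs i)) {..<k}\<rbrakk>
    \<Longrightarrow> cograph (graph_Union {..<k} Gs)"
| join: "\<lbrakk>(k::nat) > 1; \<And>i. i < k \<Longrightarrow> cograph (Gs i);
    disjoint_family_on (\<lambda>i. verts (Gs i)) {..<k}\<rbrakk>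
    \<Longrightarrow> cograph (graph_Join {..<k} Gs)"

text \<open>A matrix whose rows are indexed by a finite set \<open>S\<close> of nodes is represented by a matrix whose
  rows follow the increasing enumeration of \<open>S\<close>, so for \<open>S = {1..n}\<close> row \<open>i\<close> (counted from \<open>0\<close>)
  belongs to node \<open>i + 1\<close>.\<close>

definition node_at :: "'a::linorder set \<Rightarrow> nat \<Rightarrow> 'a" where
  "node_at S i = sorted_list_of_set S ! i"

definition adjacency :: "'a::linorder graph \<Rightarrow> real mat" where
  "adjacency G = mat (card (verts G)) (card (verts G))
     (\<lambda>(i, j). if {node_at (verts G) i, node_at (verts G) j} \<in> edges G then 1 else 0)"

definition degree_matrix :: "'a::linorder graph \<Rightarrow> real mat" where
  "degree_matrix G = mat (card (verts G)) (card (verts G))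
     (\<lambda>(i, j). if i = j then real (card {e \<in> edges G. node_at (verts G) i \<in> e}) else 0)"

definition laplacian :: "'a::linorder graph \<Rightarrow> real mat" where
  "laplacian G = degree_matrix G - adjacency G"

text \<open>Order is immaterial, so the spectrum is a multiset; one copy of the trivial eigenvalue \<open>0\<close>
  is removed. Nothing is lost by taking real roots, as the Laplacian is symmetric.\<close>

definition nontrivial_spectrum :: "'a::linorder graph \<Rightarrow> real multiset" where
  "nontrivial_spectrum G = proots (char_poly (laplacian G)) - {#0#}"

definition nontrivial_modal_matrix :: "'a::linorder graph \<Rightarrow> real list \<Rightarrow> real mat \<Rightarrow> bool" where
  "nontrivial_modal_matrix G mus M \<longleftrightarrow>
     (let n = card (verts G) in
        mset mus = nontrivial_spectrum G \<and> length mus = n - 1 \<and>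
        M \<in> carrier_mat n (n - 1) \<and>
        vec_space.rank n M = n - 1 \<and>
        (\<forall>j<n - 1. laplacian G *\<^sub>v col M j = mus ! j \<cdot>\<^sub>v col M j))"

text \<open>\<open>lab\<close> is only meaningful on internal nodes.\<close>

record 'a labelled_tree =
  nodes :: "'a set"
  arcs :: "('a \<times> 'a) set"
  root :: 'a
  lab :: "'a \<Rightarrow> nat"

definition is_path :: "('a, 'b) labelled_tree_scheme \<Rightarrow> 'a list \<Rightarrow> 'a \<Rightarrow> 'a \<Rightarrow> bool" where
  "is_path T us w v \<longleftrightarrow> us \<noteq> [] \<and> set us \<subseteq> nodes T \<and> hd us = w \<and> last us = v \<and>
     successively (\<lambda>x y. (x, y) \<in> arcs T) us"

text \<open>Here \<open>is_path\<close> admits repeated nodes, so uniqueness also excludes directed cycles and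
  in-degrees above one.\<close>

definition rooted_tree :: "('a, 'b) labelled_tree_scheme \<Rightarrow> bool" where
  "rooted_tree T \<longleftrightarrow> finite (nodes T) \<and> root T \<in> nodes T \<and> arcs T \<subseteq> nodes T \<times> nodes T \<and>
     (\<forall>v\<in>nodes T. \<exists>!us. is_path T us (root T) v)"

definition children :: "('a, 'b) labelled_tree_scheme \<Rightarrow> 'a \<Rightarrow> 'a set" where
  "children T v = {u. (v, u) \<in> arcs T}"

definition leaves :: "('a, 'b) labelled_tree_scheme \<Rightarrow> 'a set" where
  "leaves T = {v \<in> nodes T. children T v = {}}"

definition internal_nodes :: "('a, 'b) labelled_tree_scheme \<Rightarrow> 'a set" where
  "internal_nodes T = nodes T - leaves T"

definition leaves_below :: "('a, 'b) labelled_tree_scheme \<Rightarrow> 'a \<Rightarrow> 'a set" where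
  "leaves_below T v = {x \<in> leaves T. (v, x) \<in> (arcs T)\<^sup>*}"

definition num_leaves :: "('a, 'b) labelled_tree_scheme \<Rightarrow> 'a \<Rightarrow> nat" where
  "num_leaves T v = card (leaves_below T v)"

definition num_children :: "('a, 'b) labelled_tree_scheme \<Rightarrow> 'a \<Rightarrow> nat" where
  "num_children T v = card (children T v)"

definition is_cotree :: "'a graph \<Rightarrow> ('a, 'b) labelled_tree_scheme \<Rightarrow> bool" where
  "is_cotree G T \<longleftrightarrow>
     rooted_tree T \<and> leaves T = verts G \<and>
     (\<forall>v\<in>internal_nodes T. num_children T v \<ge> 2 \<and> lab T v \<in> {0, 1}) \<and>
     (\<forall>u\<in>internal_nodes T. \<forall>v\<in>internal_nodes T. (u, v) \<in> arcs T \<longrightarrow> lab T u \<noteq> lab T v) \<and>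
     (\<forall>z\<in>internal_nodes T.
        induced G (leaves_below T z) =
          (if lab T z = 0
           then graph_Union (children T z) (\<lambda>u. induced G (leaves_below T u))
           else graph_Join (children T z) (\<lambda>u. induced G (leaves_below T u)))) \<and>
     induced G (leaves_below T (root T)) = G"

definition new_eigenvalue :: "('a, 'b) labelled_tree_scheme \<Rightarrow> 'a \<Rightarrow> real" where
  "new_eigenvalue T v = real (lab T v) * real (num_leaves T v)"

definition upd_eigenvalue :: "('a, 'b) labelled_tree_scheme \<Rightarrow> 'a \<Rightarrow> 'a \<Rightarrow> real" where
  "upd_eigenvalue T w v =
     (let us = (THE us. is_path T us w v); p = length us - 1 in
        new_eigenvalue T v +
        (\<Sum>i<p. real (lab T (us ! i)) *
                 (real (num_leaves T (us ! i)) - real (num_leaves T (us ! (i + 1))))))"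

definition child_ordering :: "('a, 'b) labelled_tree_scheme \<Rightarrow> ('a \<Rightarrow> 'a list) \<Rightarrow> bool" where
  "child_ordering T ch \<longleftrightarrow>
     (\<forall>v\<in>internal_nodes T. distinct (ch v) \<and> set (ch v) = children T v)"

text \<open>The entry of the new modal matrix of \<open>v\<close> in the row of the leaf \<open>x\<close> below \<open>v\<close> and in
  column \<open>j\<close>; both columns and children are counted from \<open>1\<close> here.\<close>

definition new_modal_entry ::
  "('a, 'b) labelled_tree_scheme \<Rightarrow> ('a \<Rightarrow> 'a list) \<Rightarrow> 'a \<Rightarrow> 'a \<Rightarrow> nat \<Rightarrow> real" where
  "new_modal_entry T ch v x j =
     (let child = (\<lambda>i. ch v ! (i - 1));
          n = (\<lambda>i. real (num_leaves T (child i)));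
          i = (THE i. i \<in> {1..length (ch v)} \<and> x \<in> leaves_below T (child i))
      in if i \<le> j then n (j + 1)
         else if i = j + 1 then - (\<Sum>t=1..j. n t)
         else 0)"

definition upd_modal_matrix ::
  "('a::linorder, 'b) labelled_tree_scheme \<Rightarrow> ('a \<Rightarrow> 'a list) \<Rightarrow> 'a \<Rightarrow> 'a \<Rightarrow> real mat" where
  "upd_modal_matrix T ch w v = mat (num_leaves T w) (num_children T v - 1)
     (\<lambda>(a, j). let x = node_at (leaves_below T w) a in
        if x \<in> leaves_below T v then new_modal_entry T ch v x (j + 1) else 0)"

end

theory Submission
  imports Defs "Jordan_Normal_Form.Gram_Schmidt"
begin

text \<open>Read a column of the updated modal matrix of \<open>v\<close> as a function \<open>f\<close> on the nodes of \<open>G\<close>. It is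
  supported on the leaves below \<open>v\<close>, constant on the leaves below each child of \<open>v\<close>, and has sum
  zero. The leaves below \<open>v\<close> have the same neighbours outside, so the Laplacian of \<open>f\<close> vanishes
  outside them because the sum is zero; at a leaf below \<open>v\<close>, the outside neighbours contribute
  their number times \<open>f\<close>, which is the path sum in the updated eigenvalue, and the inside ones
  contribute the new eigenvalue times \<open>f\<close>. Hence \<open>f\<close> is an eigenvector.

  All these columns together with the constant vector are pairwise orthogonal: for two nodes
  one above the other, the upper function is constant on the support of the lower one, and
  incomparable nodes give disjoint supports. Counting the arcs of the tree shows that there are
  \<open>n\<close> of them, so they form an eigenbasis.\<close>

subsection \<open>Orthogonal eigenbases\<close>

text \<open>Over the reals \<open>corthogonal\<close> means pairwise orthogonal with nonzero
  self-products. The Gram matrix is therefore diagonal with nonzero diagonal entries, and its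
  determinant is the square of the one in question.\<close>

lemma det_corthogonal_cols:
  fixes us :: "real vec list"
  assumes us: "set us \<subseteq> carrier_vec n" "length us = n" and orth: "corthogonal us"
  shows "det (mat_of_cols n us) \<noteq> 0"
proof -
  let ?P = "mat_of_cols n us"
  have P: "?P \<in> carrier_mat n n" using us by auto
  have entry: "(?P\<^sup>T * ?P) $$ (i, j) = us ! i \<bullet> us ! j" if "i < n" "j < n" for i j
    using that us by (auto simp: times_mat_def col_mat_of_cols subset_code(1))
  have zero: "us ! i \<bullet> us ! j = 0 \<longleftrightarrow> i \<noteq> j" if "i < n" "j < n" for i j
    using corthogonalD[OF orth, of i j] that us by simp
  have "upper_triangular (?P\<^sup>T * ?P)"
    using P zero entry by (auto simp: upper_triangular_def)
  moreover have "0 \<notin> set (diag_mat (?P\<^sup>T * ?P))"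
    using P zero entry by (auto simp: diag_mat_def)
  ultimately have "det (?P\<^sup>T * ?P) \<noteq> 0"
    using P det_upper_triangular[of "?P\<^sup>T * ?P" n] by (auto simp: prod_list_zero_iff)
  then show ?thesis
    using P det_mult[of "?P\<^sup>T" n ?P] by auto
qed

text \<open>The eigenvector equations say \<open>A * P = P * D\<close> with \<open>D\<close>
  diagonal and \<open>P\<close> invertible. So \<open>A\<close> is similar to \<open>D\<close> and
  shares its characteristic polynomial, a product of linear factors whose roots with multiplicity
  are \<open>ds\<close>.\<close>

lemma proots_char_poly_corthogonal_eigenbasis:
  fixes A :: "real mat"
  assumes A: "A \<in> carrier_mat n n"
    and us: "set us \<subseteq> carrier_vec n" "length us = n" and orth: "corthogonal us"
    and ds: "length ds = n"
    and eig: "\<And>i. i < n \<Longrightarrow> A *\<^sub>v us ! i = ds ! i \<cdot>\<^sub>v us ! i"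
  shows "proots (char_poly A) = mset ds"
proof -
  let ?P = "mat_of_cols n us" and ?D = "mat_diag n (\<lambda>i. ds ! i)"
  have P: "?P \<in> carrier_mat n n" using us by auto
  from det_non_zero_imp_unit[OF P det_corthogonal_cols[OF us orth], unfolded Units_def, of "()"]
  obtain Q where Q: "Q \<in> carrier_mat n n" and QP: "Q * ?P = 1\<^sub>m n" and PQ: "?P * Q = 1\<^sub>m n"
    by (auto simp: ring_mat_def)
  have D: "?D \<in> carrier_mat n n" by simp
  have "A * ?P = ?P * ?D"
  proof (rule eq_matI)
    fix i j assume "i < dim_row (?P * ?D)" "j < dim_col (?P * ?D)"
    then have ij: "i < n" "j < n" by (auto simp: mat_diag_def)
    have c: "col ?P j = us ! j" "us ! j \<in> carrier_vec n"
      using ij us by (auto simp: col_mat_of_cols subset_code(1))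
    have "(A * ?P) $$ (i, j) = (A *\<^sub>v us ! j) $ i"
      using A ij c us(2) by simp
    also have "\<dots> = (?P * ?D) $$ (i, j)"
      using ij us c P by (simp add: eig mat_diag_mult_right[OF P] mat_of_cols_index)
    finally show "(A * ?P) $$ (i, j) = (?P * ?D) $$ (i, j)" .
  qed (use A us in \<open>auto simp: mat_diag_def\<close>)
  then have "A = ?P * ?D * Q"
    using A P Q PQ assoc_mult_mat[of A n n ?P n Q n] by simp
  then have "similar_mat_wit A ?D ?P Q"
    using A P Q PQ QP D by (intro similar_mat_witI[of _ _ n])
  then have "similar_mat A ?D" by (auto simp: similar_mat_def)
  then have "char_poly A = char_poly ?D" by (rule char_poly_similar)
  also have "\<dots> = (\<Prod>a\<leftarrow>diag_mat ?D. [:- a, 1:])"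
    by (rule char_poly_upper_triangular[of _ n]) (auto simp: upper_triangular_def mat_diag_def)
  also have "diag_mat ?D = ds"
    using ds by (auto simp: diag_mat_def mat_diag_def intro!: nth_equalityI)
  also have "proots (\<Prod>a\<leftarrow>ds. [:- a, 1:]) = mset ds"
  proof (induction ds)
    case (Cons d ds)
    have "(\<Prod>a\<leftarrow>ds. [:- a, 1:]) \<noteq> 0" by (auto simp: prod_list_zero_iff)
    then show ?case
      using Cons.IH proots_mult[of "[:- d, 1:]" "\<Prod>a\<leftarrow>ds. [:- a, 1:]"]
      by (simp del: mult_pCons_left)
  qed simp
  finally show ?thesis .
qed

text \<open>Any subset of the independent columns of an invertible matrix is independent. Since
  \<open>lin_indpt\<close> speaks of sets, \<open>distinct vs\<close> is what turns this into a
  count of columns.\<close>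

lemma rank_corthogonal_sublist:
  fixes us :: "real vec list"
  assumes us: "set us \<subseteq> carrier_vec n" "length us = n" and orth: "corthogonal us"
    and vs: "distinct vs" "set vs \<subseteq> set us"
  shows "vec_space.rank n (mat_of_cols n vs) = length vs"
proof -
  interpret vec_space "TYPE(real)" n .
  let ?P = "mat_of_cols n us"
  have P: "?P \<in> carrier_mat n n" "cols ?P = us" using us by auto
  have "lin_indpt (set us)"
    using det_corthogonal_cols[OF us orth] det_rank_iff[OF P(1)]
      full_rank_lin_indpt[OF P(1)] corthogonal_distinct[OF orth] P(2) by auto
  then have "lin_indpt (set vs)" using vs(2) by (rule subset_li_is_li)
  moreover have "cols (mat_of_cols n vs) = vs" using vs us by auto
  ultimately show ?thesis
    using lin_indpt_full_rank[of "mat_of_cols n vs" "length vs"] vs by auto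
qed

lemma distinct_concat_map:
  assumes "distinct xs" and "\<And>x. x \<in> set xs \<Longrightarrow> distinct (f x)"
    and "\<And>x y. \<lbrakk>x \<in> set xs; y \<in> set xs; x \<noteq> y\<rbrakk> \<Longrightarrow> set (f x) \<inter> set (f y) = {}"
  shows "distinct (concat (map f xs))"
  using assms
proof (induction xs)
  case (Cons a xs)
  have "set (f a) \<inter> set (f y) = {}" if "y \<in> set xs" for y
    using that Cons.prems(1) by (intro Cons.prems(3)) auto
  moreover have "distinct (concat (map f xs))"
    using Cons.prems by (intro Cons.IH) auto
  ultimately show ?case using Cons.prems(2) by auto
qed simp

subsection \<open>Rooted trees\<close>

lemma successively_imp_rtrancl:
  "\<lbrakk>successively (\<lambda>x y. (x, y) \<in> r) us; us \<noteq> []\<rbrakk> \<Longrightarrow> (hd us, last us) \<in> r\<^sup>*"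
  by (induction us) (auto simp: successively_Cons intro: converse_rtrancl_into_rtrancl)

locale rooted_labelled_tree =
  fixes T :: "('a, 'b) labelled_tree_scheme"
  assumes rooted: "rooted_tree T"
begin

text \<open>This is the description inside \<open>upd_eigenvalue\<close> at the root, so the flipped
  equation rewrites one into the other.\<close>

definition path_to :: "'a \<Rightarrow> 'a list" where
  "path_to v = (THE us. is_path T us (root T) v)"

lemma finite_nodes: "finite (nodes T)"
  and root_in_nodes: "root T \<in> nodes T"
  and arcs_subset: "arcs T \<subseteq> nodes T \<times> nodes T"
  using rooted by (auto simp: rooted_tree_def)

lemma finite_arcs: "finite (arcs T)"
  using arcs_subset finite_nodes by (meson finite_SigmaI finite_subset)

lemma path_to_eqI:
  assumes "is_path T us (root T) v"
  shows "path_to v = us"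
proof -
  have "v \<in> nodes T" using assms by (auto simp: is_path_def)
  then have "\<exists>!us. is_path T us (root T) v" using rooted by (auto simp: rooted_tree_def)
  then show ?thesis unfolding path_to_def using assms by (rule the1_equality)
qed

lemma is_path_path_to:
  assumes "v \<in> nodes T"
  shows "is_path T (path_to v) (root T) v"
proof -
  have "\<exists>us. is_path T us (root T) v" using rooted assms by (auto simp: rooted_tree_def)
  then show ?thesis using path_to_eqI by metis
qed

lemma path_to_root: "path_to (root T) = [root T]"
  using root_in_nodes by (intro path_to_eqI) (auto simp: is_path_def)

lemma last_path_to: "v \<in> nodes T \<Longrightarrow> path_to v \<noteq> [] \<and> last (path_to v) = v"
  using is_path_path_to by (auto simp: is_path_def)

text \<open>Appending an arc to the path of \<open>u\<close> gives a path to \<open>w\<close>, and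
  root paths are unique. Unique parents, depth and acyclicity all follow from this
  recursion.\<close>

lemma path_to_arc:
  assumes "(u, w) \<in> arcs T"
  shows "path_to w = path_to u @ [w]"
proof -
  have "u \<in> nodes T" "w \<in> nodes T" using assms arcs_subset by auto
  then show ?thesis
    using is_path_path_to[of u] assms
    by (intro path_to_eqI) (auto simp: is_path_def successively_append_iff)
qed

lemma parent_unique:
  assumes "(u, w) \<in> arcs T" "(u', w) \<in> arcs T"
  shows "u = u'"
proof -
  have "path_to u = path_to u'" using path_to_arc[OF assms(1)] path_to_arc[OF assms(2)] by simp
  moreover have "u \<in> nodes T" "u' \<in> nodes T" using assms arcs_subset by auto
  ultimately show ?thesis using last_path_to by metis
qed

lemma no_arc_to_root: "(u, root T) \<notin> arcs T"
proof
  assume a: "(u, root T) \<in> arcs T"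
  then have "path_to u = []" using path_to_arc[OF a] path_to_root by simp
  then show False using a arcs_subset last_path_to by blast
qed

text \<open>The length of \<open>path_to\<close> serves as depth: each arc raises it by one.\<close>

lemma length_path_to_less:
  "(u, w) \<in> (arcs T)\<^sup>+ \<Longrightarrow> length (path_to u) < length (path_to w)"
  by (induction rule: trancl_induct) (auto simp: path_to_arc)

lemma acyclic_arcs: "acyclic (arcs T)"
  using length_path_to_less by (auto simp: acyclic_def)

lemma root_reaches:
  assumes "v \<in> nodes T"
  shows "(root T, v) \<in> (arcs T)\<^sup>*"
  using is_path_path_to[OF assms] successively_imp_rtrancl[of "arcs T" "path_to v"]
  by (auto simp: is_path_def)

lemma children_subset: "children T v \<subseteq> nodes T"
  using arcs_subset by (auto simp: children_def)

lemma finite_children: "finite (children T v)"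
  using children_subset finite_nodes finite_subset by blast

lemma internal_nodes_iff: "v \<in> internal_nodes T \<longleftrightarrow> children T v \<noteq> {}"
  using arcs_subset by (auto simp: internal_nodes_def leaves_def children_def)

lemma internal_in_nodes: "v \<in> internal_nodes T \<Longrightarrow> v \<in> nodes T"
  by (simp add: internal_nodes_def)

section \<open>Leaf sets of subtrees and arc counting\<close>

lemma finite_leaves_below: "finite (leaves_below T v)"
  using finite_nodes by (simp add: leaves_below_def leaves_def)

lemma leaves_below_mono: "(u, w) \<in> (arcs T)\<^sup>* \<Longrightarrow> leaves_below T w \<subseteq> leaves_below T u"
  by (auto simp: leaves_below_def)

lemma leaves_below_child: "u \<in> children T v \<Longrightarrow> leaves_below T u \<subseteq> leaves_below T v"
  by (intro leaves_below_mono) (auto simp: children_def)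

lemma leaves_below_root: "leaves_below T (root T) = leaves T"
  using root_reaches by (auto simp: leaves_below_def leaves_def)

lemma leaves_below_internal:
  assumes "v \<in> internal_nodes T"
  shows "leaves_below T v = (\<Union>u\<in>children T v. leaves_below T u)"
proof
  show "leaves_below T v \<subseteq> (\<Union>u\<in>children T v. leaves_below T u)"
  proof
    fix x assume x: "x \<in> leaves_below T v"
    then have "v \<noteq> x" using assms by (auto simp: internal_nodes_def leaves_below_def)
    then obtain u where "(v, u) \<in> arcs T" "(u, x) \<in> (arcs T)\<^sup>*"
      using x by (auto simp: leaves_below_def elim: converse_rtranclE)
    then show "x \<in> (\<Union>u\<in>children T v. leaves_below T u)"
      using x by (auto simp: leaves_below_def children_def)
  qed
qed (use leaves_below_child in blast)

text \<open>Induction upwards from the leaves, well-founded because the arcs are finite and acyclic: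
  an internal node inherits a leaf from any child.\<close>

lemma leaves_below_nonempty: "v \<in> nodes T \<Longrightarrow> leaves_below T v \<noteq> {}"
proof (induction v rule: wf_induct_rule[OF finite_acyclic_wf_converse[OF finite_arcs acyclic_arcs]])
  case (1 v)
  show ?case
  proof (cases "v \<in> leaves T")
    case True
    then show ?thesis by (auto simp: leaves_below_def)
  next
    case False
    then obtain u where u: "u \<in> children T v"
      using 1(2) by (auto simp: leaves_def)
    then have "leaves_below T u \<noteq> {}"
      using 1(1)[of u] children_subset by (auto simp: children_def)
    then show ?thesis using leaves_below_child[OF u] by auto
  qed
qed

text \<open>Parents are unique, so the reversed arcs are single-valued and the ancestors of
  \<open>x\<close> form a chain.\<close>

lemma comparable_if_common_descendant:
  assumes "(u, x) \<in> (arcs T)\<^sup>*" "(w, x) \<in> (arcs T)\<^sup>*"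
  shows "(u, w) \<in> (arcs T)\<^sup>* \<or> (w, u) \<in> (arcs T)\<^sup>*"
proof -
  have "single_valued ((arcs T)\<inverse>)"
    using parent_unique by (auto simp: single_valued_def)
  from single_valued_confluent[OF this, of x u w] show ?thesis
    using assms by (auto simp: rtrancl_converse)
qed

text \<open>A common leaf would make two siblings comparable, hence of different depth, yet both lie
  one level below \<open>v\<close>.\<close>

lemma leaves_below_disjoint_children:
  assumes "u \<in> children T v" "w \<in> children T v" "u \<noteq> w"
  shows "leaves_below T u \<inter> leaves_below T w = {}"
proof (rule ccontr)
  assume "leaves_below T u \<inter> leaves_below T w \<noteq> {}"
  then have "(u, w) \<in> (arcs T)\<^sup>* \<or> (w, u) \<in> (arcs T)\<^sup>*"
    using comparable_if_common_descendant by (auto simp: leaves_below_def)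
  then have "(u, w) \<in> (arcs T)\<^sup>+ \<or> (w, u) \<in> (arcs T)\<^sup>+"
    using assms(3) by (auto simp: rtrancl_eq_or_trancl)
  moreover have "length (path_to u) = length (path_to w)"
    using assms by (simp add: children_def path_to_arc)
  ultimately show False using length_path_to_less by (metis less_irrefl)
qed

text \<open>Double counting of arcs: by heads there is one for every node except the root, by tails
  \<open>num_children\<close> for every internal node.\<close>

lemma sum_num_children: "(\<Sum>v\<in>internal_nodes T. num_children T v) = card (nodes T) - 1"
proof -
  have "bij_betw snd (arcs T) (nodes T - {root T})"
  proof (rule bij_betw_imageI)
    show "inj_on snd (arcs T)" using parent_unique by (auto simp: inj_on_def)
    show "snd ` arcs T = nodes T - {root T}"
    proof (intro equalityI subsetI)
      fix w assume w: "w \<in> nodes T - {root T}"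
      then have "(root T, w) \<in> (arcs T)\<^sup>*" "w \<noteq> root T" using root_reaches by auto
      then obtain u where "(u, w) \<in> arcs T" by (auto elim: rtranclE)
      then show "w \<in> snd ` arcs T" by force
    qed (use arcs_subset no_arc_to_root in auto)
  qed
  then have "card (arcs T) = card (nodes T) - 1"
    using root_in_nodes by (simp add: bij_betw_same_card)
  moreover have "arcs T = (SIGMA v:internal_nodes T. children T v)"
    by (auto simp: internal_nodes_iff) (auto simp: children_def)
  then have "card (arcs T) = (\<Sum>v\<in>internal_nodes T. num_children T v)"
    using finite_nodes finite_children
    by (simp add: num_children_def internal_nodes_def)
  ultimately show ?thesis by simp
qed

end

subsection \<open>Cotrees and their modal functions\<close>

locale ordered_cotree =
  fixes G :: "'a::linorder graph" and T :: "('a, 'b) labelled_tree_scheme"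
    and ch :: "'a \<Rightarrow> 'a list"
  assumes simple: "simple_graph G" and cotree: "is_cotree G T" and ordering: "child_ordering T ch"
begin

sublocale rooted_labelled_tree T
  using cotree by unfold_locales (simp add: is_cotree_def)

lemma leaves_eq: "leaves T = verts G"
  using cotree by (simp add: is_cotree_def)

lemma leaves_below_subset: "leaves_below T v \<subseteq> verts G"
  using leaves_eq by (auto simp: leaves_below_def)

lemma lab_cases: "v \<in> internal_nodes T \<Longrightarrow> lab T v = 0 \<or> lab T v = 1"
  and num_children_ge: "v \<in> internal_nodes T \<Longrightarrow> num_children T v \<ge> 2"
  and ch_distinct: "v \<in> internal_nodes T \<Longrightarrow> distinct (ch v)"
  and set_ch: "v \<in> internal_nodes T \<Longrightarrow> set (ch v) = children T v"
  using cotree ordering by (auto simp: is_cotree_def child_ordering_def)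

lemma length_ch: "v \<in> internal_nodes T \<Longrightarrow> length (ch v) = num_children T v"
  using ch_distinct set_ch by (metis distinct_card num_children_def)

section \<open>Adjacency read off the cotree labels\<close>

definition adj :: "'a \<Rightarrow> 'a \<Rightarrow> real" where
  "adj x y = (if {x, y} \<in> edges G then 1 else 0)"

text \<open>In a union every edge stays inside the leaves of one child, and these leaf sets are
  disjoint; a join contains all cross edges.\<close>

lemma adj_eq_lab:
  assumes v: "v \<in> internal_nodes T" and ch: "u \<in> children T v" "w \<in> children T v" "u \<noteq> w"
    and xy: "x \<in> leaves_below T u" "y \<in> leaves_below T w"
  shows "adj x y = real (lab T v)"
proof -
  have ind: "induced G (leaves_below T v) =
          (if lab T v = 0
           then graph_Union (children T v) (\<lambda>u. induced G (leaves_below T u))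
           else graph_Join (children T v) (\<lambda>u. induced G (leaves_below T u)))"
    using cotree v by (auto simp: is_cotree_def)
  have sub: "{x, y} \<subseteq> leaves_below T v"
    using xy leaves_below_child ch by auto
  have edge_iff: "{x, y} \<in> edges G \<longleftrightarrow> {x, y} \<in> edges (induced G (leaves_below T v))"
    using sub by (auto simp: induced_def)
  show ?thesis
  proof (cases "lab T v = 0")
    case True
    have "{x, y} \<notin> edges G"
    proof
      assume "{x, y} \<in> edges G"
      then obtain t where "t \<in> children T v" "{x, y} \<subseteq> leaves_below T t"
        using True unfolding edge_iff ind by (auto simp: graph_Union_def induced_def)
      then show False
        using leaves_below_disjoint_children ch xy by (metis disjoint_iff insert_subset)
    qed
    then show ?thesis using True by (simp add: adj_def)
  next
    case False
    have "{x, y} \<in> cross_edges (verts (induced G (leaves_below T u))) (verts (induced G (leaves_below T w)))"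
      using xy leaves_below_subset by (auto simp: cross_edges_def induced_def)
    then have "{x, y} \<in> edges G"
      using False ch unfolding edge_iff ind graph_Join_def by auto
    then show ?thesis using False lab_cases[OF v] by (simp add: adj_def)
  qed
qed

lemma adj_eq_lab_child:
  assumes u: "u \<in> children T v" and x: "x \<in> leaves_below T u"
    and y: "y \<in> leaves_below T v - leaves_below T u"
  shows "adj x y = real (lab T v)" "adj y x = real (lab T v)"
proof -
  have v: "v \<in> internal_nodes T" using u by (auto simp: internal_nodes_iff)
  then obtain w where "w \<in> children T v" "y \<in> leaves_below T w"
    using y leaves_below_internal by auto
  then show "adj x y = real (lab T v)" "adj y x = real (lab T v)"
    using adj_eq_lab[OF v] u x y by auto
qed

text \<open>Going down the root path of \<open>v\<close>, the node \<open>x\<close> drops out of the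
  leaf set at some arc. There its adjacency to everything below the lower end is the label of the
  upper end.\<close>

lemma leaves_below_module:
  assumes "v \<in> nodes T"
  shows "\<lbrakk>x \<in> verts G - leaves_below T v; y \<in> leaves_below T v; z \<in> leaves_below T v\<rbrakk>
    \<Longrightarrow> adj x y = adj x z"
  using root_reaches[OF assms]
proof (induction rule: rtrancl_induct)
  case base
  then show ?case using leaves_below_root leaves_eq by auto
next
  case (step v w)
  have w: "w \<in> children T v" using step(2) by (simp add: children_def)
  show ?case
  proof (cases "x \<in> leaves_below T v")
    case True
    then show ?thesis using adj_eq_lab_child(2)[OF w] step by auto
  next
    case False
    then show ?thesis using step leaves_below_child[OF w] by auto
  qed
qed

text \<open>The path sum counts outside neighbours: the leaves dropped when passing from a node to
  the next one on the path are all adjacent to \<open>x\<close> or all non-adjacent, according to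
  the label of the upper node.\<close>

lemma sum_adj_outside:
  assumes "v \<in> nodes T"
  shows "x \<in> leaves_below T v \<Longrightarrow>
    (\<Sum>y\<in>verts G - leaves_below T v. adj x y) = upd_eigenvalue T (root T) v - new_eigenvalue T v"
  using root_reaches[OF assms]
proof (induction rule: rtrancl_induct)
  case base
  show ?case using path_to_root leaves_below_root leaves_eq
    by (simp add: upd_eigenvalue_def flip: path_to_def)
next
  case (step v w)
  have w: "w \<in> children T v" using step(2) by (simp add: children_def)
  have v: "v \<in> nodes T" using step(2) arcs_subset by auto
  have sub: "leaves_below T w \<subseteq> leaves_below T v" by (rule leaves_below_child[OF w])
  define g where "g us i = real (lab T (us ! i)) *
      (real (num_leaves T (us ! i)) - real (num_leaves T (us ! (i + 1))))" for us i
  have upd: "upd_eigenvalue T (root T) u - new_eigenvalue T u =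
      (\<Sum>i<length (path_to u) - 1. g (path_to u) i)" for u
    by (simp add: upd_eigenvalue_def g_def Let_def flip: path_to_def)
  obtain us where us: "path_to v = us @ [v]"
    using last_path_to[OF v] by (metis append_butlast_last_id)
  have "path_to w = us @ [v, w]" using path_to_arc[OF step(2)] us by simp
  \<comment> \<open>The paths to \<open>v\<close> and \<open>w\<close> agree up to index
    \<open>length us\<close>, so the sum for \<open>w\<close> has just one extra term, that of the
    arc from \<open>v\<close> to \<open>w\<close>.\<close>
  then have "(\<Sum>i<length (path_to w) - 1. g (path_to w) i) =
      (\<Sum>i<length us. g (us @ [v, w]) i) + g (us @ [v, w]) (length us)"
    by simp
  also have "(\<Sum>i<length us. g (us @ [v, w]) i) = (\<Sum>i<length (path_to v) - 1. g (path_to v) i)"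
    unfolding us by (intro sum.cong) (auto simp: g_def nth_append)
  finally have upd_w: "upd_eigenvalue T (root T) w - new_eigenvalue T w =
      upd_eigenvalue T (root T) v - new_eigenvalue T v +
      real (lab T v) * (real (num_leaves T v) - real (num_leaves T w))"
    unfolding upd by (simp add: g_def nth_append)
  have "verts G - leaves_below T w =
      (verts G - leaves_below T v) \<union> (leaves_below T v - leaves_below T w)"
    using sub leaves_below_subset by blast
  then have "(\<Sum>y\<in>verts G - leaves_below T w. adj x y) =
      (\<Sum>y\<in>verts G - leaves_below T v. adj x y) + (\<Sum>y\<in>leaves_below T v - leaves_below T w. adj x y)"
    using simple finite_leaves_below by (auto simp: simple_graph_def intro!: sum.union_disjoint)
  also have "(\<Sum>y\<in>leaves_below T v - leaves_below T w. adj x y) =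
      (\<Sum>y\<in>leaves_below T v - leaves_below T w. real (lab T v))"
    using adj_eq_lab_child(1)[OF w] step.prems by (intro sum.cong) auto
  also have "\<dots> = real (lab T v) * (real (num_leaves T v) - real (num_leaves T w))"
    using sub finite_leaves_below
    by (simp add: num_leaves_def card_Diff_subset of_nat_diff card_mono)
  finally show ?case using upd_w step sub by auto
qed

text \<open>Children and columns are counted from \<open>1\<close>, as in \<open>new_modal_entry\<close>.\<close>

definition block :: "'a \<Rightarrow> nat \<Rightarrow> 'a set" where
  "block v i = leaves_below T (ch v ! (i - 1))"

definition modal_coeff :: "'a \<Rightarrow> nat \<Rightarrow> nat \<Rightarrow> real" where
  "modal_coeff v j i = (if i \<le> j then real (card (block v (j + 1)))
     else if i = j + 1 then - (\<Sum>t=1..j. real (card (block v t))) else 0)"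

definition modal_fun :: "'a \<Rightarrow> nat \<Rightarrow> 'a \<Rightarrow> real" where
  "modal_fun v j x = (if x \<in> leaves_below T v then new_modal_entry T ch v x j else 0)"

lemma child_at:
  assumes "v \<in> internal_nodes T" "i \<in> {1..num_children T v}"
  shows "ch v ! (i - 1) \<in> children T v"
proof -
  have "i - 1 < length (ch v)" using assms length_ch by auto
  then show ?thesis using nth_mem set_ch[OF assms(1)] by auto
qed

lemma child_index:
  assumes "v \<in> internal_nodes T" "u \<in> children T v"
  obtains i where "i \<in> {1..num_children T v}" "u = ch v ! (i - 1)"
proof -
  obtain k where "k < length (ch v)" "ch v ! k = u"
    using assms set_ch by (metis in_set_conv_nth)
  then show ?thesis using length_ch[OF assms(1)] by (intro that[of "k + 1"]) auto
qed

lemma block_disjoint: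
  assumes "v \<in> internal_nodes T" "i \<in> {1..num_children T v}" "k \<in> {1..num_children T v}" "i \<noteq> k"
  shows "block v i \<inter> block v k = {}"
proof -
  have "ch v ! (i - 1) \<noteq> ch v ! (k - 1)"
    using assms ch_distinct[OF assms(1)] length_ch[OF assms(1)] by (auto simp: nth_eq_iff_index_eq)
  then show ?thesis
    unfolding block_def using assms child_at by (intro leaves_below_disjoint_children) auto
qed

lemma leaves_below_blocks:
  assumes "v \<in> internal_nodes T"
  shows "leaves_below T v = (\<Union>i\<in>{1..num_children T v}. block v i)"
  using leaves_below_internal[OF assms] child_at[OF assms] child_index[OF assms]
  unfolding block_def by blast

text \<open>Disjointness of the blocks makes \<open>i\<close> the only index fitting the definite
  description in \<open>new_modal_entry\<close>, which from here on is replaced by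
  \<open>modal_coeff\<close>.\<close>

lemma modal_fun_block:
  assumes v: "v \<in> internal_nodes T" and i: "i \<in> {1..num_children T v}" and x: "x \<in> block v i"
  shows "modal_fun v j x = modal_coeff v j i"
proof -
  have "(THE i. i \<in> {1..length (ch v)} \<and> x \<in> leaves_below T (ch v ! (i - 1))) = i"
    using i x block_disjoint[OF v] unfolding length_ch[OF v] block_def[symmetric]
    by (intro the_equality) blast+
  moreover have "x \<in> leaves_below T v" using leaves_below_blocks[OF v] i x by auto
  ultimately show ?thesis
    by (simp add: modal_fun_def new_modal_entry_def modal_coeff_def block_def num_leaves_def)
qed

lemma modal_fun_outside: "x \<notin> leaves_below T v \<Longrightarrow> modal_fun v j x = 0"
  by (simp add: modal_fun_def)

lemma sum_leaves_below:
  assumes v: "v \<in> internal_nodes T"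
  shows "(\<Sum>x\<in>leaves_below T v. g x) = (\<Sum>i=1..num_children T v. \<Sum>x\<in>block v i. g x)"
  unfolding leaves_below_blocks[OF v]
  using block_disjoint[OF v] finite_leaves_below
  by (intro sum.UNION_disjoint) (auto simp: block_def)

lemma sum_verts_leaves_below:
  assumes "\<And>x. x \<notin> leaves_below T v \<Longrightarrow> g x = 0"
  shows "(\<Sum>x\<in>verts G. g x) = (\<Sum>x\<in>leaves_below T v. g x)"
  using simple assms leaves_below_subset by (intro sum.mono_neutral_right) (auto simp: simple_graph_def)

text \<open>With block sizes \<open>n_i\<close>, the first \<open>j\<close> blocks contribute
  \<open>(n_1 + ... + n_j) * n_(j+1)\<close>, block \<open>j + 1\<close> contributes the negative of
  this, and later blocks nothing.\<close>

lemma sum_modal_fun: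
  assumes v: "v \<in> internal_nodes T" and j: "1 \<le> j" "j < num_children T v"
  shows "(\<Sum>x\<in>leaves_below T v. modal_fun v j x) = 0"
proof -
  let ?n = "\<lambda>i. real (card (block v i))"
  have "(\<Sum>x\<in>leaves_below T v. modal_fun v j x) =
      (\<Sum>i=1..num_children T v. \<Sum>x\<in>block v i. modal_coeff v j i)"
    unfolding sum_leaves_below[OF v] using modal_fun_block[OF v] by (intro sum.cong) auto
  also have "\<dots> = (\<Sum>i=1..num_children T v. ?n i * modal_coeff v j i)"
    by simp
  also have "\<dots> = (\<Sum>i=1..Suc j. ?n i * modal_coeff v j i)"
    using j by (intro sum.mono_neutral_right) (auto simp: modal_coeff_def)
  also have "\<dots> = (\<Sum>i=1..j. ?n i * ?n (j + 1)) - ?n (j + 1) * (\<Sum>t=1..j. ?n t)"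
    by (simp add: modal_coeff_def)
  also have "\<dots> = 0"
    by (simp add: sum_distrib_left mult.commute)
  finally show ?thesis .
qed

lemma sum_verts_modal_fun:
  assumes "v \<in> internal_nodes T" "1 \<le> j" "j < num_children T v"
  shows "(\<Sum>x\<in>verts G. modal_fun v j x) = 0"
  using sum_verts_leaves_below[of v "modal_fun v j"] modal_fun_outside sum_modal_fun[OF assms]
  by metis

text \<open>On the first block the value is the size of block \<open>j + 1\<close>, which is
  positive since every subtree has a leaf.\<close>

lemma modal_fun_nonzero:
  assumes v: "v \<in> internal_nodes T" and j: "1 \<le> j" "j < num_children T v"
  shows "\<exists>x\<in>verts G. modal_fun v j x \<noteq> 0"
proof -
  have pos: "block v i \<noteq> {}" if "i \<in> {1..num_children T v}" for i
    using child_at[OF v that] children_subset leaves_below_nonempty unfolding block_def by blast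
  obtain x where x: "x \<in> block v 1" using pos[of 1] j by auto
  have "modal_coeff v j 1 \<noteq> 0"
    using pos[of "j + 1"] j finite_leaves_below by (simp add: modal_coeff_def block_def)
  moreover have "modal_fun v j x = modal_coeff v j 1"
    using modal_fun_block[OF v _ x] j by auto
  moreover have "x \<in> verts G" using x leaves_below_subset by (auto simp: block_def)
  ultimately show ?thesis by metis
qed

text \<open>Function \<open>j\<close> lives on blocks \<open>1\<close> to \<open>j + 1\<close>. As
  \<open>j + 1 \<le> k\<close>, function \<open>k\<close> is constant there, so the product is a
  multiple of a function with sum zero.\<close>

lemma modal_fun_orthogonal_same_node:
  assumes v: "v \<in> internal_nodes T" and j: "1 \<le> j" "j < k" "k < num_children T v"
  shows "(\<Sum>x\<in>verts G. modal_fun v j x * modal_fun v k x) = 0"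
proof -
  have eq: "modal_fun v j x * modal_fun v k x = real (card (block v (k + 1))) * modal_fun v j x" for x
  proof (cases "x \<in> leaves_below T v")
    case True
    then obtain i where i: "i \<in> {1..num_children T v}" "x \<in> block v i"
      using leaves_below_blocks[OF v] by auto
    then show ?thesis using j by (auto simp: modal_fun_block[OF v i] modal_coeff_def)
  qed (simp add: modal_fun_outside)
  show ?thesis
    using sum_verts_modal_fun[OF v, of j] j unfolding eq by (simp flip: sum_distrib_left)
qed

text \<open>All leaves below \<open>w\<close> lie in one block of \<open>v\<close>, on which the
  upper function is constant; the lower one has sum zero.\<close>

lemma modal_fun_orthogonal_descendant:
  assumes v: "v \<in> internal_nodes T" and vw: "(v, w) \<in> (arcs T)\<^sup>+"
    and w: "w \<in> internal_nodes T" and k: "1 \<le> k" "k < num_children T w"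
  shows "(\<Sum>x\<in>verts G. modal_fun v j x * modal_fun w k x) = 0"
proof -
  obtain u where u: "(v, u) \<in> arcs T" "(u, w) \<in> (arcs T)\<^sup>*"
    using vw by (meson tranclD)
  then obtain i where i: "i \<in> {1..num_children T v}" "u = ch v ! (i - 1)"
    using child_index[OF v] by (auto simp: children_def)
  have "leaves_below T w \<subseteq> block v i"
    using leaves_below_mono[OF u(2)] i(2) by (simp add: block_def)
  then have eq: "modal_fun v j x * modal_fun w k x = modal_coeff v j i * modal_fun w k x" for x
    using modal_fun_block[OF v i(1), of x j] modal_fun_outside[of x w k] by fastforce
  show ?thesis
    using sum_verts_modal_fun[OF w k] unfolding eq by (simp flip: sum_distrib_left)
qed

lemma modal_fun_orthogonal:
  assumes v: "v \<in> internal_nodes T" and j: "1 \<le> j" "j < num_children T v"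
    and w: "w \<in> internal_nodes T" and k: "1 \<le> k" "k < num_children T w"
    and ne: "(v, j) \<noteq> (w, k)"
  shows "(\<Sum>x\<in>verts G. modal_fun v j x * modal_fun w k x) = 0"
proof -
  consider "v = w" "j < k" | "v = w" "k < j" | "(v, w) \<in> (arcs T)\<^sup>+" | "(w, v) \<in> (arcs T)\<^sup>+"
    | "(v, w) \<notin> (arcs T)\<^sup>*" "(w, v) \<notin> (arcs T)\<^sup>*"
    using ne by (metis linorder_neqE_nat rtranclD)
  then show ?thesis
  proof cases
    case 1
    then show ?thesis using modal_fun_orthogonal_same_node[OF v] j k by auto
  next
    case 2
    then show ?thesis using modal_fun_orthogonal_same_node[OF v, of k j] j k
      by (auto simp: mult.commute)
  next
    case 3
    then show ?thesis using modal_fun_orthogonal_descendant[OF v _ w k] by auto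
  next
    case 4
    then show ?thesis using modal_fun_orthogonal_descendant[OF w _ v j, of k]
      by (auto simp: mult.commute)
  next
    case 5
    then have "leaves_below T v \<inter> leaves_below T w = {}"
      using comparable_if_common_descendant by (auto simp: leaves_below_def)
    then have "modal_fun v j x * modal_fun w k x = 0" for x
      using modal_fun_outside by (metis disjoint_iff mult_eq_0_iff)
    then show ?thesis by simp
  qed
qed

text \<open>The left side is the Laplacian of the modal function at \<open>x\<close>. Writing it
  with differences makes the unknown adjacencies inside the block of \<open>x\<close>
  irrelevant.\<close>

lemma modal_fun_eigen:
  assumes v: "v \<in> internal_nodes T" and j: "1 \<le> j" "j < num_children T v" and x: "x \<in> verts G"
  shows "(\<Sum>y\<in>verts G. adj x y * (modal_fun v j x - modal_fun v j y)) =
    upd_eigenvalue T (root T) v * modal_fun v j x"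
proof -
  let ?f = "modal_fun v j"
  have vn: "v \<in> nodes T" using v by (rule internal_in_nodes)
  have fin: "finite (verts G)" using simple by (simp add: simple_graph_def)
  show ?thesis
  proof (cases "x \<in> leaves_below T v")
    case False
    \<comment> \<open>By the module property, \<open>adj x z\<close> for this one representative can
      be pulled out of the sum.\<close>
    obtain z where z: "z \<in> leaves_below T v" using leaves_below_nonempty[OF vn] by auto
    have "(\<Sum>y\<in>verts G. adj x y * (?f x - ?f y)) = (\<Sum>y\<in>verts G. - adj x z * ?f y)"
    proof (intro sum.cong refl)
      fix y
      show "adj x y * (?f x - ?f y) = - adj x z * ?f y"
        using False leaves_below_module[OF vn, of x y z] x z
        by (cases "y \<in> leaves_below T v") (auto simp: modal_fun_outside)
    qed
    also have "\<dots> = - adj x z * (\<Sum>y\<in>verts G. ?f y)" by (rule sum_distrib_left[symmetric])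
    finally show ?thesis using False sum_verts_modal_fun[OF v j] by (simp add: modal_fun_outside)
  next
    case True
    then obtain i where i: "i \<in> {1..num_children T v}" "x \<in> block v i"
      using leaves_below_blocks[OF v] by auto
    \<comment> \<open>Within the block of \<open>x\<close> the difference is zero; in any other
      block the adjacency is the label.\<close>
    have inner: "adj x y * (?f x - ?f y) = real (lab T v) * (?f x - ?f y)"
      if "y \<in> leaves_below T v" for y
    proof (cases "y \<in> block v i")
      case True
      then show ?thesis using modal_fun_block[OF v i(1)] i(2) by simp
    next
      case False
      then show ?thesis
        using adj_eq_lab_child(1)[OF child_at[OF v i(1)], of x y] i(2) that by (simp add: block_def)
    qed
    have "(\<Sum>y\<in>verts G. adj x y * (?f x - ?f y)) =
        (\<Sum>y\<in>verts G - leaves_below T v. adj x y * (?f x - ?f y)) +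
        (\<Sum>y\<in>leaves_below T v. adj x y * (?f x - ?f y))"
      using fin leaves_below_subset by (intro sum.subset_diff) auto
    also have "(\<Sum>y\<in>verts G - leaves_below T v. adj x y * (?f x - ?f y)) =
        (\<Sum>y\<in>verts G - leaves_below T v. adj x y) * ?f x"
      unfolding sum_distrib_right by (intro sum.cong) (auto simp: modal_fun_outside)
    also have "(\<Sum>y\<in>leaves_below T v. adj x y * (?f x - ?f y)) =
        (\<Sum>y\<in>leaves_below T v. real (lab T v) * (?f x - ?f y))"
      using inner by (intro sum.cong) auto
    also have "\<dots> = real (lab T v) * ((\<Sum>y\<in>leaves_below T v. ?f x) - (\<Sum>y\<in>leaves_below T v. ?f y))"
      by (simp add: sum_subtractf flip: sum_distrib_left)
    also have "\<dots> = new_eigenvalue T v * ?f x"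
      using sum_modal_fun[OF v j] by (simp add: new_eigenvalue_def num_leaves_def)
    finally show ?thesis
      using sum_adj_outside[OF vn True] by (simp add: algebra_simps)
  qed
qed

end

subsection \<open>The Laplacian in coordinates\<close>

lemma bij_betw_node_at: "finite S \<Longrightarrow> bij_betw (node_at S) {..<card S} S"
  unfolding node_at_def by (rule bij_betw_nth) auto

definition node_vec :: "'a::linorder set \<Rightarrow> ('a \<Rightarrow> real) \<Rightarrow> real vec" where
  "node_vec S f = vec (card S) (\<lambda>i. f (node_at S i))"

lemma node_vec_carrier [simp]: "node_vec S f \<in> carrier_vec (card S)"
  by (simp add: node_vec_def)

lemma scalar_prod_node_vec:
  assumes "finite S"
  shows "node_vec S f \<bullet> node_vec S g = (\<Sum>x\<in>S. f x * g x)"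
  using sum.reindex_bij_betw[OF bij_betw_node_at[OF assms], of "\<lambda>x. f x * g x"]
  by (simp add: node_vec_def scalar_prod_def lessThan_atLeast0)

text \<open>Neighbours \<open>y\<close> of \<open>x\<close> correspond to incident edges through
  \<open>{x, y}\<close>, because every edge has exactly two elements.\<close>

lemma degree_eq_sum:
  assumes "simple_graph G" "x \<in> verts G"
  shows "real (card {e \<in> edges G. x \<in> e}) = (\<Sum>y\<in>verts G. if {x, y} \<in> edges G then 1 else 0)"
proof -
  have e: "e \<subseteq> verts G" "card e = 2" if "e \<in> edges G" for e
    using that assms by (auto simp: simple_graph_def)
  have "bij_betw (\<lambda>y. {x, y}) {y \<in> verts G. {x, y} \<in> edges G} {e \<in> edges G. x \<in> e}"
  proof (rule bij_betw_imageI)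
    show "inj_on (\<lambda>y. {x, y}) {y \<in> verts G. {x, y} \<in> edges G}"
      by (auto simp: inj_on_def doubleton_eq_iff)
    show "(\<lambda>y. {x, y}) ` {y \<in> verts G. {x, y} \<in> edges G} = {e \<in> edges G. x \<in> e}"
    proof (intro equalityI subsetI)
      fix a assume a: "a \<in> {e \<in> edges G. x \<in> e}"
      then obtain y where "a = {x, y}"
        using e(2)[of a] by (auto simp: card_2_iff insert_commute)
      then show "a \<in> (\<lambda>y. {x, y}) ` {y \<in> verts G. {x, y} \<in> edges G}"
        using a e(1)[of a] by auto
    qed auto
  qed
  then have "card {e \<in> edges G. x \<in> e} = card {y \<in> verts G. {x, y} \<in> edges G}"
    by (simp add: bij_betw_same_card)
  also have "real \<dots> = (\<Sum>y\<in>{y \<in> verts G. {x, y} \<in> edges G}. 1)" by simp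
  also have "\<dots> = (\<Sum>y\<in>verts G. if {x, y} \<in> edges G then 1 else 0)"
    using assms by (intro sum.inter_filter) (simp add: simple_graph_def)
  finally show ?thesis .
qed

text \<open>The degree is the row sum of the adjacency, so diagonal and off-diagonal parts merge
  into differences.\<close>

lemma laplacian_node_vec:
  assumes G: "simple_graph G"
  shows "laplacian G *\<^sub>v node_vec (verts G) f =
    node_vec (verts G) (\<lambda>x. \<Sum>y\<in>verts G. (if {x, y} \<in> edges G then 1 else 0) * (f x - f y))"
proof (rule eq_vecI)
  let ?V = "verts G" and ?a = "\<lambda>x y. if {x, y} \<in> edges G then 1 else (0::real)"
  have fin: "finite ?V" using G by (simp add: simple_graph_def)
  fix i assume "i < dim_vec (node_vec ?V (\<lambda>x. \<Sum>y\<in>?V. ?a x y * (f x - f y)))"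
  then have i: "i < card ?V" by (simp add: node_vec_def)
  define x where "x = node_at ?V i"
  have x: "x \<in> ?V" using bij_betw_node_at[OF fin] i unfolding x_def by (auto dest: bij_betwE)
  have inj: "node_at ?V k = x \<longleftrightarrow> k = i" if "k < card ?V" for k
    using bij_betw_node_at[OF fin] that i unfolding x_def bij_betw_def inj_on_def by auto
  have "(laplacian G *\<^sub>v node_vec ?V f) $ i =
      (\<Sum>k<card ?V. ((if i = k then real (card {e \<in> edges G. x \<in> e}) else 0)
        - ?a x (node_at ?V k)) * f (node_at ?V k))"
    using i by (simp add: laplacian_def degree_matrix_def adjacency_def node_vec_def
        scalar_prod_def lessThan_atLeast0 x_def cong: if_cong)
  \<comment> \<open>Phrasing the diagonal condition through nodes makes the summand a function of
    \<open>node_at ?V k\<close>, so the sum can be reindexed over nodes.\<close>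
  also have "\<dots> = (\<Sum>k<card ?V. ((if node_at ?V k = x then real (card {e \<in> edges G. x \<in> e}) else 0)
        - ?a x (node_at ?V k)) * f (node_at ?V k))"
    using inj by (intro sum.cong) auto
  also have "\<dots> = (\<Sum>y\<in>?V. ((if y = x then real (card {e \<in> edges G. x \<in> e}) else 0) - ?a x y) * f y)"
    by (rule sum.reindex_bij_betw[OF bij_betw_node_at[OF fin]])
  also have "\<dots> = real (card {e \<in> edges G. x \<in> e}) * f x - (\<Sum>y\<in>?V. ?a x y * f y)"
    using x fin by (simp add: left_diff_distrib sum_subtractf if_distrib[where f = "\<lambda>z. z * _"] cong: if_cong)
  also have "\<dots> = (\<Sum>y\<in>?V. ?a x y * (f x - f y))"
    unfolding degree_eq_sum[OF G x] by (simp add: sum_distrib_right right_diff_distrib sum_subtractf)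
  finally show "(laplacian G *\<^sub>v node_vec ?V f) $ i =
      node_vec ?V (\<lambda>x. \<Sum>y\<in>?V. ?a x y * (f x - f y)) $ i"
    using i by (simp add: node_vec_def x_def)
qed (simp add: laplacian_def adjacency_def node_vec_def)

text \<open>At the root the rows run over all of \<open>verts G\<close>. Matrix columns start at
  \<open>0\<close> and modal functions at \<open>1\<close>, hence \<open>Suc j\<close>.\<close>

lemma cols_upd_modal_matrix:
  assumes "ordered_cotree G T ch"
  shows "cols (upd_modal_matrix T ch (root T) v) =
    map (\<lambda>j. node_vec (verts G) (ordered_cotree.modal_fun T ch v (Suc j))) [0..<num_children T v - 1]"
proof -
  interpret ordered_cotree G T ch by (rule assms)
  have "num_leaves T (root T) = card (verts G)"
    by (simp add: num_leaves_def leaves_below_root leaves_eq)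
  then show ?thesis
    by (auto simp: upd_modal_matrix_def node_vec_def modal_fun_def Let_def
        leaves_below_root leaves_eq intro!: nth_equalityI eq_vecI)
qed

section \<open>Assembling the eigenbasis over all internal nodes\<close>

theorem theorem4:
  fixes G :: "nat graph" and T :: "nat labelled_tree"
    and n h :: nat and v :: "nat \<Rightarrow> nat" and ch :: "nat \<Rightarrow> nat list"
    and lam :: "nat \<Rightarrow> real" and VV :: "nat \<Rightarrow> real mat"
    and Lam :: "real list" and M :: "real mat"
  assumes "simple_graph G" and "cograph G" and "verts G = {1..n}"
    and "is_cotree G T"
    and "child_ordering T ch"
    and "h = card (nodes T) - card (verts G)"
    and "bij_betw v {1..h} (internal_nodes T)"
    and "\<And>i. i \<in> {1..h} \<Longrightarrow> lam i = upd_eigenvalue T (root T) (v i)"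
    and "\<And>i. i \<in> {1..h} \<Longrightarrow> VV i = upd_modal_matrix T ch (root T) (v i)"
    and "Lam = concat (map (\<lambda>i. replicate (num_children T (v i) - 1) (lam i)) [1..<h + 1])"
    and "M = mat_of_cols n (concat (map (\<lambda>i. cols (VV i)) [1..<h + 1]))"
  shows "nontrivial_spectrum G = mset Lam \<and> nontrivial_modal_matrix G Lam M"
proof -
  interpret ordered_cotree G T ch using assms by unfold_locales auto
  let ?c = "\<lambda>i. num_children T (v i)"
  have card_V: "card (verts G) = n" and fin: "finite (verts G)" using assms(3) by auto
  have internal: "v i \<in> internal_nodes T" if "i \<in> {1..h}" for i
    using bij_betwE[OF assms(7)] that by auto
  have inj: "v i = v k \<longleftrightarrow> i = k" if "i \<in> {1..h}" "k \<in> {1..h}" for i k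
    using inj_on_eq_iff[OF bij_betw_imp_inj_on[OF assms(7)]] that by blast

  \<comment> \<open>One common index list for \<open>Lam\<close> and the columns of
    \<open>M\<close>: both become maps over it, so eigenvalues and eigenvectors match by
    position.\<close>
  define idx where "idx = concat (map (\<lambda>i. map (\<lambda>j. (v i, Suc j)) [0..<?c i - 1]) [1..<h + 1])"
  define vs where "vs = map (\<lambda>(w, j). node_vec (verts G) (modal_fun w j)) idx"
  define us where "us = node_vec (verts G) (\<lambda>_. 1) # vs"

  have idx: "w \<in> internal_nodes T \<and> 1 \<le> j \<and> j < num_children T w" if "(w, j) \<in> set idx" for w j
    using that internal unfolding idx_def by auto
  have distinct_idx: "distinct idx"
    unfolding idx_def
    by (rule distinct_concat_map) (auto simp: distinct_map inj_on_def inj)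
  have Lam: "Lam = map (\<lambda>(w, j). upd_eigenvalue T (root T) w) idx"
    unfolding assms(10) idx_def map_concat
    by (auto simp: assms(8) o_def map_replicate_const intro!: arg_cong[of _ _ concat])
  have M: "M = mat_of_cols n vs"
    unfolding assms(11) vs_def idx_def map_concat
    using cols_upd_modal_matrix[OF ordered_cotree_axioms]
    by (auto simp: assms(9) o_def intro!: arg_cong[of _ _ "mat_of_cols n"] arg_cong[of _ _ concat])

  \<comment> \<open>The leaves are among the nodes, so the subtraction defining \<open>h\<close>
    does not truncate. Arc counting then gives \<open>h + n - 1\<close> children in total;
    subtracting one per internal node leaves \<open>n - 1\<close> columns.\<close>
  have "card (nodes T) = h + n"
    using finite_nodes card_mono[of "nodes T" "leaves T"] assms(6) card_V leaves_eq
    by (auto simp: leaves_def)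
  then have "(\<Sum>w\<in>internal_nodes T. num_children T w) = h + n - 1"
    using sum_num_children by simp
  moreover have "(\<Sum>w\<in>internal_nodes T. num_children T w) =
      (\<Sum>w\<in>internal_nodes T. num_children T w - 1) + card (internal_nodes T)"
  proof -
    have "(\<Sum>w\<in>internal_nodes T. num_children T w) =
        (\<Sum>w\<in>internal_nodes T. (num_children T w - 1) + 1)"
      using num_children_ge by (intro sum.cong) fastforce+
    then show ?thesis by (simp only: sum.distrib) simp
  qed
  moreover have "card (internal_nodes T) = h"
    using bij_betw_same_card[OF assms(7)] by simp
  moreover have "length idx = (\<Sum>w\<in>internal_nodes T. num_children T w - 1)"
  proof -
    have "length idx = (\<Sum>i\<leftarrow>[1..<h + 1]. ?c i - 1)"
      by (simp add: idx_def length_concat o_def)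
    also have "\<dots> = (\<Sum>i\<in>{1..h}. ?c i - 1)"
      by (subst sum_list_distinct_conv_sum_set) (auto intro: sum.cong)
    also have "\<dots> = (\<Sum>w\<in>internal_nodes T. num_children T w - 1)"
      by (rule sum.reindex_bij_betw[OF assms(7)])
    finally show ?thesis .
  qed
  ultimately have "length idx = n - 1" by simp
  \<comment> \<open>Positivity makes \<open>n - 1\<close> an honest predecessor, so adding the
    constant vector gives exactly \<open>n\<close> vectors.\<close>
  moreover have "n > 0"
    using leaves_below_nonempty[OF root_in_nodes] leaves_below_subset fin card_V
    by (metis card_gt_0_iff subset_empty)
  ultimately have len: "length idx = n - 1" "length vs = n - 1" "length us = n" "length (0 # Lam) = n"
    by (auto simp: vs_def us_def Lam)

  have vs_nth: "vs ! i = node_vec (verts G) (modal_fun (fst (idx ! i)) (snd (idx ! i)))"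
    if "i < n - 1" for i
    using that len by (simp add: vs_def split_beta)
  have idx_nth: "fst (idx ! i) \<in> internal_nodes T" "1 \<le> snd (idx ! i)"
      "snd (idx ! i) < num_children T (fst (idx ! i))" if "i < n - 1" for i
    using idx[of "fst (idx ! i)" "snd (idx ! i)"] that len by auto
  have us_carrier: "set us \<subseteq> carrier_vec n"
    using node_vec_carrier[of "verts G"] unfolding card_V by (auto simp: us_def vs_def)

  have orth_vs: "vs ! i \<bullet> vs ! k = 0 \<longleftrightarrow> i \<noteq> k" if "i < n - 1" "k < n - 1" for i k
  proof (cases "i = k")
    case True
    have "(\<Sum>x\<in>verts G. f x * f x) \<noteq> 0" if "\<exists>x\<in>verts G. f x \<noteq> 0" for f :: "nat \<Rightarrow> real"
      using that fin by (auto simp: sum_nonneg_eq_0_iff)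
    then show ?thesis
      using True that modal_fun_nonzero[OF idx_nth] by (simp add: vs_nth scalar_prod_node_vec[OF fin])
  next
    case False
    then have "idx ! i \<noteq> idx ! k" using that len distinct_idx by (simp add: nth_eq_iff_index_eq)
    then show ?thesis
      using False that modal_fun_orthogonal[OF idx_nth(1-3) idx_nth(1-3), of i k]
      by (simp add: vs_nth scalar_prod_node_vec[OF fin])
  qed
  have orth_one: "vs ! i \<bullet> node_vec (verts G) (\<lambda>_. 1) = 0" "node_vec (verts G) (\<lambda>_. 1) \<bullet> vs ! i = 0"
    if "i < n - 1" for i
    using that sum_verts_modal_fun[OF idx_nth] by (simp_all add: vs_nth scalar_prod_node_vec[OF fin])
  \<comment> \<open>Index \<open>0\<close> is the constant vector, with self-product
    \<open>n\<close>; its orthogonality to the rest is the zero-sum property.\<close>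
  have "corthogonal us"
  proof (rule corthogonalI)
    fix i k assume "i < length us" "k < length us"
    then show "us ! i \<bullet>c us ! k = 0 \<longleftrightarrow> i \<noteq> k"
      using orth_vs orth_one card_V \<open>n > 0\<close> len fin
      by (cases i; cases k) (auto simp: us_def scalar_prod_node_vec[OF fin])
  qed

  have eig: "laplacian G *\<^sub>v vs ! i = Lam ! i \<cdot>\<^sub>v vs ! i" if "i < n - 1" for i
  proof -
    have x: "node_at (verts G) k \<in> verts G" if "k < card (verts G)" for k
      using bij_betwE[OF bij_betw_node_at[OF fin]] that by auto
    show ?thesis
      using that len modal_fun_eigen[OF idx_nth x] unfolding vs_nth[OF that] laplacian_node_vec[OF simple]
      by (auto simp: node_vec_def Lam split_beta simp flip: adj_def)
  qed
  have eig_one: "laplacian G *\<^sub>v node_vec (verts G) (\<lambda>_. 1) = 0 \<cdot>\<^sub>v node_vec (verts G) (\<lambda>_. 1)"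
    unfolding laplacian_node_vec[OF simple] by (auto simp: node_vec_def)
  \<comment> \<open>The head \<open>0\<close> belongs to the constant vector and is the copy that
    \<open>nontrivial_spectrum\<close> removes.\<close>
  have "proots (char_poly (laplacian G)) = mset (0 # Lam)"
  proof (rule proots_char_poly_corthogonal_eigenbasis[OF _ us_carrier len(3) \<open>corthogonal us\<close> len(4)])
    show "laplacian G \<in> carrier_mat n n"
      by (simp add: laplacian_def degree_matrix_def adjacency_def card_V minus_carrier_mat)
    fix i assume "i < n"
    then show "laplacian G *\<^sub>v us ! i = (0 # Lam) ! i \<cdot>\<^sub>v us ! i"
      using eig eig_one by (cases i) (auto simp: us_def)
  qed
  then have spec: "nontrivial_spectrum G = mset Lam"
    by (simp add: nontrivial_spectrum_def)
  have "distinct vs" "set vs \<subseteq> set us"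
    using corthogonal_distinct[OF \<open>corthogonal us\<close>] by (auto simp: us_def)
  then have "vec_space.rank n M = n - 1"
    using rank_corthogonal_sublist[OF us_carrier len(3) \<open>corthogonal us\<close>] len(2) M by auto
  moreover have "col M j = vs ! j" if "j < n - 1" for j
    using that len us_carrier nth_mem[of j vs] unfolding M us_def by (auto intro!: col_mat_of_cols)
  moreover have "M \<in> carrier_mat n (n - 1)" using M len by auto
  ultimately have "nontrivial_modal_matrix G Lam M"
    using eig spec len unfolding nontrivial_modal_matrix_def card_V by (auto simp: Let_def)
  then show ?thesis using spec by simp
qed

end
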